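(* Let $R$ be a pseudomeadow and $\mathfrak{m}$ a maximal ideal of $R$. Then: (a) $R_{\mathfrak{m}}$ is a field. In particular, $\mathfrak{m}_{\mathfrak{m}}=(0)$. (b) The canonical map $f_{\mathfrak{m}}:R\to R_{\mathfrak{m}}$, given by $f_{\mathfrak{m}}(x)=\frac{xs}{s}$ (where $s$ is any element of $R\setminus\mathfrak{m}$), is surjective. Its kernel is $\mathfrak{m}$, so that, by passing to the quotient, the map $\widetilde{f_{\mathfrak{m}}}:R/\mathfrak{m}\to R_{\mathfrak{m}}$, given by $\widetilde{f_{\mathfrak{m}}}(x+\mathfrak{m})=\frac{xs}{s}$, is an isomorphism. (c) For any $s\in R\setminus\mathfrak{m}$, the preimage $f_{\mathfrak{m}}^{-1}(s/s)$ is the coset $e(s)+\mathfrak{m}$. (d) $e(s_1)-e(s_2)\in\mathfrak{m}$ for any $s_1,s_2\in R\setminus\mathfrak{m}$.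
   Context: A pseudoring is a commutative associative ring that is not required to have a multiplicative identity. A pseudomeadow is a pseudoring $R$ in which every $x\in R$ has a von Neumann inverse, i.e. an element $x^{(-1)}\in R$ (necessarily unique) with $x\,x\,x^{(-1)}=x$ and $x\,x^{(-1)}x^{(-1)}=x^{(-1)}$; put $e(x):=x\,x^{(-1)}$. An ideal $\mathfrak{m}$ is maximal if $\mathfrak{m}\ne R$ and every ideal $I\supseteq\mathfrak{m}$ satisfies $I=\mathfrak{m}$ or $I=R$. In a pseudomeadow every maximal ideal is prime (proper, and $xy\in\mathfrak{m}$ implies $x\in\mathfrak{m}$ or $y\in\mathfrak{m}$), so $R\setminus\mathfrak{m}$ is non-empty and multiplicatively closed. For a non-empty multiplicatively closed set $S$, the localization $S^{-1}R$ is defined as for rings: fractions $r/s$ with $r\in R$, $s\in S$, where $r/s=r'/s'$ iff $(rs'-r's)u=0$ for some $u\in S$, with the usual operations; it is a ring with identity $s/s$ ($s\in S$ arbitrary). For a prime ideal $\mathfrak{p}$, $R_{\mathfrak{p}}:=(R\setminus\mathfrak{p})^{-1}R$, and for an ideal $I$ of $R$, $I_{\mathfrak{p}}=\{a/s: a\in I,\ s\in R\setminus\mathfrak{p}\}$. Isomorphism means a bijective map preserving addition and multiplication. *)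

theory Defs
  imports "HOL-Algebra.QuotRing"
begin

section \<open>Pseudorings and pseudomeadows\<close>

text \<open>
  Pseudorings are carried by the ring records of HOL-Algebra, but the field \<open>\<one>\<close> of the record
  is left unconstrained and plays no role in any of the notions for pseudorings.  The locales
  \<open>ring\<close>, \<open>ideal\<close>, \<open>maximalideal\<close> and the sets \<open>ring_hom\<close>, \<open>ring_iso\<close> of the library all
  presuppose an identity, which is why they have to be restated here.
\<close>

locale pseudoring = abelian_group R for R (structure) +
  assumes m_closed [intro, simp]:
      "\<lbrakk>x \<in> carrier R; y \<in> carrier R\<rbrakk> \<Longrightarrow> x \<otimes> y \<in> carrier R"
    and m_assoc:
      "\<lbrakk>x \<in> carrier R; y \<in> carrier R; z \<in> carrier R\<rbrakk> \<Longrightarrow> (x \<otimes> y) \<otimes> z = x \<otimes> (y \<otimes> z)"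
    and m_comm:
      "\<lbrakk>x \<in> carrier R; y \<in> carrier R\<rbrakk> \<Longrightarrow> x \<otimes> y = y \<otimes> x"
    and l_distr:
      "\<lbrakk>x \<in> carrier R; y \<in> carrier R; z \<in> carrier R\<rbrakk> \<Longrightarrow> (x \<oplus> y) \<otimes> z = x \<otimes> z \<oplus> y \<otimes> z"

definition is_vn_inverse :: "('a, 'm) ring_scheme \<Rightarrow> 'a \<Rightarrow> 'a \<Rightarrow> bool" where
  "is_vn_inverse R x y \<longleftrightarrow>
     y \<in> carrier R \<and> x \<otimes>\<^bsub>R\<^esub> x \<otimes>\<^bsub>R\<^esub> y = x \<and> x \<otimes>\<^bsub>R\<^esub> y \<otimes>\<^bsub>R\<^esub> y = y"

locale pseudomeadow = pseudoring +
  assumes vn_inverse_exists: "x \<in> carrier R \<Longrightarrow> \<exists>y. is_vn_inverse R x y"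

definition vn_inv :: "('a, 'm) ring_scheme \<Rightarrow> 'a \<Rightarrow> 'a" where
  "vn_inv R x = (THE y. is_vn_inverse R x y)"

definition vn_idem :: "('a, 'm) ring_scheme \<Rightarrow> 'a \<Rightarrow> 'a" where
  "vn_idem R x = x \<otimes>\<^bsub>R\<^esub> vn_inv R x"

locale pseudoring_ideal = additive_subgroup I R + pseudoring R for I and R (structure) +
  assumes I_l_closed: "\<lbrakk>a \<in> I; x \<in> carrier R\<rbrakk> \<Longrightarrow> x \<otimes> a \<in> I"

locale pseudoring_maximal_ideal = pseudoring_ideal M R for M and R (structure) +
  assumes proper: "M \<noteq> carrier R"
    and maximal: "\<lbrakk>pseudoring_ideal I R; M \<subseteq> I\<rbrakk> \<Longrightarrow> I = M \<or> I = carrier R"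

definition pseudoring_iso :: "('a, 'm) ring_scheme \<Rightarrow> ('b, 'n) ring_scheme \<Rightarrow> ('a \<Rightarrow> 'b) set" where
  "pseudoring_iso R S =
     {h. bij_betw h (carrier R) (carrier S) \<and>
         (\<forall>x\<in>carrier R. \<forall>y\<in>carrier R.
            h (x \<oplus>\<^bsub>R\<^esub> y) = h x \<oplus>\<^bsub>S\<^esub> h y \<and> h (x \<otimes>\<^bsub>R\<^esub> y) = h x \<otimes>\<^bsub>S\<^esub> h y)}"


section \<open>Localization\<close>

definition fraction_rel :: "('a, 'm) ring_scheme \<Rightarrow> 'a set \<Rightarrow> (('a \<times> 'a) \<times> ('a \<times> 'a)) set" where
  "fraction_rel R S =
     {((r, s), (r', s')). r \<in> carrier R \<and> s \<in> S \<and> r' \<in> carrier R \<and> s' \<in> S \<and>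
        (\<exists>u\<in>S. (r \<otimes>\<^bsub>R\<^esub> s' \<ominus>\<^bsub>R\<^esub> r' \<otimes>\<^bsub>R\<^esub> s) \<otimes>\<^bsub>R\<^esub> u = \<zero>\<^bsub>R\<^esub>)}"

definition fraction :: "('a, 'm) ring_scheme \<Rightarrow> 'a set \<Rightarrow> 'a \<Rightarrow> 'a \<Rightarrow> ('a \<times> 'a) set" where
  "fraction R S r s = fraction_rel R S `` {(r, s)}"

text \<open>
  As in \<^const>\<open>rcoset_mult\<close>, an operation on classes is the union of the results over all
  choices of representatives; since the operations do not depend on these choices, the union is
  a single class (see \<open>fraction_add\<close>, \<open>fraction_mult\<close>, \<open>localization_zero\<close> and
  \<open>localization_one\<close> below).
\<close>

definition localization :: "('a, 'm) ring_scheme \<Rightarrow> 'a set \<Rightarrow> ('a \<times> 'a) set ring" where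
  "localization R S =
     \<lparr>carrier = (carrier R \<times> S) // fraction_rel R S,
      mult = (\<lambda>X Y. \<Union>(r, s)\<in>X. \<Union>(r', s')\<in>Y. fraction R S (r \<otimes>\<^bsub>R\<^esub> r') (s \<otimes>\<^bsub>R\<^esub> s')),
      one = (\<Union>s\<in>S. fraction R S s s),
      zero = (\<Union>s\<in>S. fraction R S \<zero>\<^bsub>R\<^esub> s),
      add = (\<lambda>X Y. \<Union>(r, s)\<in>X. \<Union>(r', s')\<in>Y.
               fraction R S (r \<otimes>\<^bsub>R\<^esub> s' \<oplus>\<^bsub>R\<^esub> r' \<otimes>\<^bsub>R\<^esub> s) (s \<otimes>\<^bsub>R\<^esub> s'))\<rparr>"

text \<open>The map \<open>x \<mapsto> xs/s\<close>; again the union is over all choices of \<open>s\<close>.\<close>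

definition localization_map :: "('a, 'm) ring_scheme \<Rightarrow> 'a set \<Rightarrow> 'a \<Rightarrow> ('a \<times> 'a) set" where
  "localization_map R S x = (\<Union>s\<in>S. fraction R S (x \<otimes>\<^bsub>R\<^esub> s) s)"

definition localized_ideal :: "('a, 'm) ring_scheme \<Rightarrow> 'a set \<Rightarrow> 'a set \<Rightarrow> ('a \<times> 'a) set set" where
  "localized_ideal R S I = {fraction R S a s | a s. a \<in> I \<and> s \<in> S}"

text \<open>The localizations at a prime ideal \<open>P\<close>.\<close>

abbreviation fraction_at :: "('a, 'm) ring_scheme \<Rightarrow> 'a set \<Rightarrow> 'a \<Rightarrow> 'a \<Rightarrow> ('a \<times> 'a) set" where
  "fraction_at R P \<equiv> fraction R (carrier R - P)"

abbreviation localization_at :: "('a, 'm) ring_scheme \<Rightarrow> 'a set \<Rightarrow> ('a \<times> 'a) set ring" where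
  "localization_at R P \<equiv> localization R (carrier R - P)"

abbreviation localization_map_at :: "('a, 'm) ring_scheme \<Rightarrow> 'a set \<Rightarrow> 'a \<Rightarrow> ('a \<times> 'a) set" where
  "localization_map_at R P \<equiv> localization_map R (carrier R - P)"

abbreviation localized_ideal_at :: "('a, 'm) ring_scheme \<Rightarrow> 'a set \<Rightarrow> 'a set \<Rightarrow> ('a \<times> 'a) set set" where
  "localized_ideal_at R P \<equiv> localized_ideal R (carrier R - P)"

text \<open>The map which \<open>h\<close> induces on a quotient: the common value of \<open>h\<close> on a coset.\<close>

definition induced_map :: "('a \<Rightarrow> 'b) \<Rightarrow> 'a set \<Rightarrow> 'b" where
  "induced_map h X = the_elem (h ` X)"


section \<open>Well-definedness\<close>

context pseudoring
begin

lemma m_lcomm: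
  assumes "x \<in> carrier R" "y \<in> carrier R" "z \<in> carrier R"
  shows "x \<otimes> (y \<otimes> z) = y \<otimes> (x \<otimes> z)"
  using assms by (metis m_assoc m_comm)

lemmas m_ac = m_assoc m_comm m_lcomm

lemma r_distr:
  assumes "x \<in> carrier R" "y \<in> carrier R" "z \<in> carrier R"
  shows "z \<otimes> (x \<oplus> y) = z \<otimes> x \<oplus> z \<otimes> y"
  using assms by (simp add: m_comm[of z] l_distr)

lemma l_null [simp]:
  assumes "x \<in> carrier R" shows "\<zero> \<otimes> x = \<zero>"
proof -
  have "\<zero> \<otimes> x \<oplus> \<zero> \<otimes> x = \<zero> \<otimes> x \<oplus> \<zero>"
    using assms by (simp flip: l_distr)
  then show ?thesis using assms by (simp del: r_zero)
qed

lemma l_minus: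
  assumes "x \<in> carrier R" "y \<in> carrier R"
  shows "\<ominus> x \<otimes> y = \<ominus> (x \<otimes> y)"
proof -
  have "\<ominus> x \<otimes> y \<oplus> x \<otimes> y = \<zero>"
    using assms by (simp add: l_neg flip: l_distr)
  then show ?thesis using assms by (metis a_inv_closed m_closed minus_equality)
qed

lemma minus_mult_eq_zero_iff:
  assumes "x \<in> carrier R" "y \<in> carrier R" "u \<in> carrier R"
  shows "(x \<ominus> y) \<otimes> u = \<zero> \<longleftrightarrow> x \<otimes> u = y \<otimes> u"
proof -
  have "(x \<ominus> y) \<otimes> u = x \<otimes> u \<ominus> y \<otimes> u"
    using assms by (simp add: a_minus_def l_distr l_minus)
  moreover have "a \<ominus> b = \<zero> \<longleftrightarrow> a = b" if "a \<in> carrier R" "b \<in> carrier R" for a b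
    using that by (metis a_minus_def a_inv_closed minus_equality minus_minus r_neg)
  ultimately show ?thesis using assms by simp
qed

lemma vn_inverse_unique:
  assumes x: "x \<in> carrier R" and "is_vn_inverse R x y" "is_vn_inverse R x z"
  shows "y = z"
proof -
  have *: "b = x \<otimes> a \<otimes> b" if "is_vn_inverse R x a" "is_vn_inverse R x b" for a b
  proof -
    have c: "a \<in> carrier R" "b \<in> carrier R" and a: "x \<otimes> x \<otimes> a = x" and b: "x \<otimes> b \<otimes> b = b"
      using that by (auto simp: is_vn_inverse_def)
    have "b = (x \<otimes> x \<otimes> a) \<otimes> b \<otimes> b" using a b by simp
    also have "\<dots> = x \<otimes> a \<otimes> (x \<otimes> b \<otimes> b)" using x c by (simp add: m_ac)
    finally show ?thesis using b by simp
  qed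
  have "y \<in> carrier R" "z \<in> carrier R" using assms by (auto simp: is_vn_inverse_def)
  then show ?thesis using *[of y z] *[of z y] assms x by (simp add: m_ac)
qed

end

lemma (in pseudomeadow) vn_inv:
  assumes "x \<in> carrier R" shows "is_vn_inverse R x (vn_inv R x)"
  unfolding vn_inv_def
  by (rule theI') (use assms vn_inverse_exists vn_inverse_unique in blast)

locale pseudoring_localization = pseudoring R for R (structure) and S +
  assumes S_subset: "S \<subseteq> carrier R"
    and S_nonempty: "S \<noteq> {}"
    and S_closed: "\<lbrakk>s \<in> S; t \<in> S\<rbrakk> \<Longrightarrow> s \<otimes> t \<in> S"
begin

lemma S_carrier [simp]: "s \<in> S \<Longrightarrow> s \<in> carrier R"
  using S_subset by blast

lemma fraction_rel_iff:
  "((r, s), (r', s')) \<in> fraction_rel R S \<longleftrightarrow>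
     r \<in> carrier R \<and> s \<in> S \<and> r' \<in> carrier R \<and> s' \<in> S \<and>
     (\<exists>u\<in>S. r \<otimes> s' \<otimes> u = r' \<otimes> s \<otimes> u)"
  unfolding fraction_rel_def by (auto simp: minus_mult_eq_zero_iff)

lemma equiv_fraction_rel: "equiv (carrier R \<times> S) (fraction_rel R S)"
proof (rule equivI)
  show "fraction_rel R S \<subseteq> (carrier R \<times> S) \<times> (carrier R \<times> S)"
    by (auto simp: fraction_rel_def)
  show "refl_on (carrier R \<times> S) (fraction_rel R S)"
    using S_nonempty by (auto simp: refl_on_def fraction_rel_iff)
  show "sym (fraction_rel R S)"
    by (rule symI) (auto simp: fraction_rel_iff, metis)
  show "trans (fraction_rel R S)"
  proof (rule transI, clarify)
    fix a s b t c w
    assume "((a, s), (b, t)) \<in> fraction_rel R S" "((b, t), (c, w)) \<in> fraction_rel R S"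
    then obtain u v where *: "a \<in> carrier R" "b \<in> carrier R" "c \<in> carrier R"
        "s \<in> S" "t \<in> S" "w \<in> S" "u \<in> S" "v \<in> S"
      and u: "a \<otimes> t \<otimes> u = b \<otimes> s \<otimes> u" and v: "b \<otimes> w \<otimes> v = c \<otimes> t \<otimes> v"
      by (auto simp: fraction_rel_iff)
    have "a \<otimes> w \<otimes> (t \<otimes> u \<otimes> v) = (a \<otimes> t \<otimes> u) \<otimes> (w \<otimes> v)" using * by (simp add: m_ac)
    also have "\<dots> = (b \<otimes> w \<otimes> v) \<otimes> (s \<otimes> u)" unfolding u using * by (simp add: m_ac)
    also have "\<dots> = c \<otimes> s \<otimes> (t \<otimes> u \<otimes> v)" unfolding v using * by (simp add: m_ac)
    finally show "((a, s), (c, w)) \<in> fraction_rel R S"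
      using * S_closed by (auto simp: fraction_rel_iff)
  qed
qed

lemma fraction_eq_iff:
  assumes "r \<in> carrier R" "s \<in> S" "r' \<in> carrier R" "s' \<in> S"
  shows "fraction R S r s = fraction R S r' s' \<longleftrightarrow> (\<exists>u\<in>S. r \<otimes> s' \<otimes> u = r' \<otimes> s \<otimes> u)"
  unfolding fraction_def
  using assms eq_equiv_class_iff[OF equiv_fraction_rel, of "(r, s)" "(r', s')"]
  by (simp add: fraction_rel_iff)

lemma fraction_self: "\<lbrakk>r \<in> carrier R; s \<in> S\<rbrakk> \<Longrightarrow> (r, s) \<in> fraction R S r s"
  unfolding fraction_def using S_nonempty by (auto simp: fraction_rel_iff)

lemma mem_fraction:
  assumes "(r', s') \<in> fraction R S r s"
  shows "r' \<in> carrier R \<and> s' \<in> S \<and> (\<exists>u\<in>S. r \<otimes> s' \<otimes> u = r' \<otimes> s \<otimes> u)"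
  using assms by (auto simp: fraction_def fraction_rel_iff)

lemma UN_pairs_const:
  assumes "(r, s) \<in> X" "(r', s') \<in> Y"
    and "\<And>a t a' t'. \<lbrakk>(a, t) \<in> X; (a', t') \<in> Y\<rbrakk> \<Longrightarrow> F a t a' t' = C"
  shows "(\<Union>(a, t)\<in>X. \<Union>(a', t')\<in>Y. F a t a' t') = C"
proof
  show "(\<Union>(a, t)\<in>X. \<Union>(a', t')\<in>Y. F a t a' t') \<subseteq> C" using assms(3) by blast
  show "C \<subseteq> (\<Union>(a, t)\<in>X. \<Union>(a', t')\<in>Y. F a t a' t')" using assms by blast
qed

lemma fraction_add:
  assumes r: "r \<in> carrier R" "s \<in> S" "r' \<in> carrier R" "s' \<in> S"
  shows "fraction R S r s \<oplus>\<^bsub>localization R S\<^esub> fraction R S r' s' =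
           fraction R S (r \<otimes> s' \<oplus> r' \<otimes> s) (s \<otimes> s')"
proof -
  have *: "fraction R S (a \<otimes> t' \<oplus> a' \<otimes> t) (t \<otimes> t') =
           fraction R S (r \<otimes> s' \<oplus> r' \<otimes> s) (s \<otimes> s')"
    if a: "(a, t) \<in> fraction R S r s" "(a', t') \<in> fraction R S r' s'" for a t a' t'
  proof -
    obtain u u' where u: "u \<in> S" "u' \<in> S"
        "a \<otimes> s \<otimes> u = r \<otimes> t \<otimes> u" "a' \<otimes> s' \<otimes> u' = r' \<otimes> t' \<otimes> u'"
      and c: "a \<in> carrier R" "t \<in> S" "a' \<in> carrier R" "t' \<in> S"
      using a[THEN mem_fraction] by metis
    have 1: "(a \<otimes> t') \<otimes> (s \<otimes> s') \<otimes> (u \<otimes> u') = (r \<otimes> s') \<otimes> (t \<otimes> t') \<otimes> (u \<otimes> u')"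
    proof -
      have "(a \<otimes> t') \<otimes> (s \<otimes> s') \<otimes> (u \<otimes> u') = (a \<otimes> s \<otimes> u) \<otimes> (t' \<otimes> s' \<otimes> u')"
        using r u(1,2) c by (simp add: m_ac)
      also have "\<dots> = (r \<otimes> s') \<otimes> (t \<otimes> t') \<otimes> (u \<otimes> u')"
        unfolding u(3) using r u(1,2) c by (simp add: m_ac)
      finally show ?thesis .
    qed
    have 2: "(a' \<otimes> t) \<otimes> (s \<otimes> s') \<otimes> (u \<otimes> u') = (r' \<otimes> s) \<otimes> (t \<otimes> t') \<otimes> (u \<otimes> u')"
    proof -
      have "(a' \<otimes> t) \<otimes> (s \<otimes> s') \<otimes> (u \<otimes> u') = (a' \<otimes> s' \<otimes> u') \<otimes> (t \<otimes> s \<otimes> u)"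
        using r u(1,2) c by (simp add: m_ac)
      also have "\<dots> = (r' \<otimes> s) \<otimes> (t \<otimes> t') \<otimes> (u \<otimes> u')"
        unfolding u(4) using r u(1,2) c by (simp add: m_ac)
      finally show ?thesis .
    qed
    have "(a \<otimes> t' \<oplus> a' \<otimes> t) \<otimes> (s \<otimes> s') \<otimes> (u \<otimes> u') =
          (r \<otimes> s' \<oplus> r' \<otimes> s) \<otimes> (t \<otimes> t') \<otimes> (u \<otimes> u')"
      using r u(1,2) c 1 2 by (simp add: l_distr)
    then show ?thesis
      using r c u(1,2) S_closed by (subst fraction_eq_iff) auto
  qed
  show ?thesis
    unfolding localization_def ring.simps monoid.simps
    by (rule UN_pairs_const[OF fraction_self[OF r(1,2)] fraction_self[OF r(3,4)] *])
qed

lemma fraction_mult: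
  assumes r: "r \<in> carrier R" "s \<in> S" "r' \<in> carrier R" "s' \<in> S"
  shows "fraction R S r s \<otimes>\<^bsub>localization R S\<^esub> fraction R S r' s' =
           fraction R S (r \<otimes> r') (s \<otimes> s')"
proof -
  have *: "fraction R S (a \<otimes> a') (t \<otimes> t') = fraction R S (r \<otimes> r') (s \<otimes> s')"
    if a: "(a, t) \<in> fraction R S r s" "(a', t') \<in> fraction R S r' s'" for a t a' t'
  proof -
    obtain u u' where u: "u \<in> S" "u' \<in> S"
        "a \<otimes> s \<otimes> u = r \<otimes> t \<otimes> u" "a' \<otimes> s' \<otimes> u' = r' \<otimes> t' \<otimes> u'"
      and c: "a \<in> carrier R" "t \<in> S" "a' \<in> carrier R" "t' \<in> S"
      using a[THEN mem_fraction] by metis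
    have "(a \<otimes> a') \<otimes> (s \<otimes> s') \<otimes> (u \<otimes> u') = (a \<otimes> s \<otimes> u) \<otimes> (a' \<otimes> s' \<otimes> u')"
      using r u(1,2) c by (simp add: m_ac)
    also have "\<dots> = (r \<otimes> r') \<otimes> (t \<otimes> t') \<otimes> (u \<otimes> u')"
      unfolding u(3,4) using r u(1,2) c by (simp add: m_ac)
    finally show ?thesis
      using r c u(1,2) S_closed by (subst fraction_eq_iff) auto
  qed
  show ?thesis
    unfolding localization_def ring.simps monoid.simps
    by (rule UN_pairs_const[OF fraction_self[OF r(1,2)] fraction_self[OF r(3,4)] *])
qed

lemma localization_zero: "s \<in> S \<Longrightarrow> \<zero>\<^bsub>localization R S\<^esub> = fraction R S \<zero> s"
proof -
  assume s: "s \<in> S"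
  have "fraction R S \<zero> t = fraction R S \<zero> s" if "t \<in> S" for t
    using s that S_nonempty by (subst fraction_eq_iff) auto
  then have "(\<Union>t\<in>S. fraction R S \<zero> t) = fraction R S \<zero> s" using s by blast
  then show ?thesis by (simp add: localization_def)
qed

lemma localization_one: "s \<in> S \<Longrightarrow> \<one>\<^bsub>localization R S\<^esub> = fraction R S s s"
proof -
  assume s: "s \<in> S"
  have "fraction R S t t = fraction R S s s" if "t \<in> S" for t
    using s that S_nonempty by (subst fraction_eq_iff) (auto simp: m_comm[of t s])
  then have "(\<Union>t\<in>S. fraction R S t t) = fraction R S s s" using s by blast
  then show ?thesis by (simp add: localization_def)
qed

end

end

theory Submission
  imports Defs
begin

text \<open>
  Everything rests on the fact that \<open>au = bu\<close> for some \<open>u \<notin> \<mm>\<close> if and only if \<open>a - b \<in> \<mm>\<close>: an element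
  \<open>m\<close> of \<open>\<mm>\<close> is annihilated by \<open>u = s - e(m)s \<notin> \<mm>\<close>, for any \<open>s \<notin> \<mm>\<close>.  Hence \<open>f\<^sub>\<mm>(x) = f\<^sub>\<mm>(y)\<close> if and only
  if \<open>x - y \<in> \<mm>\<close>.  Moreover \<open>x/s = f\<^sub>\<mm>(x s\<^bsup>(-1)\<^esup>)\<close> and \<open>f\<^sub>\<mm>(e(s)) = s/s\<close>.
\<close>

section \<open>Localizations of pseudorings\<close>

context pseudoring_localization
begin

section \<open>The ring structure on the fractions\<close>

lemma carrier_localization:
  "carrier (localization R S) = {fraction R S r s | r s. r \<in> carrier R \<and> s \<in> S}"
  by (auto simp: localization_def quotient_def fraction_def)

lemma fraction_closed [simp]:
  "\<lbrakk>r \<in> carrier R; s \<in> S\<rbrakk> \<Longrightarrow> fraction R S r s \<in> carrier (localization R S)"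
  by (auto simp: carrier_localization)

lemma carrier_localizationE:
  assumes "x \<in> carrier (localization R S)"
  obtains r s where "r \<in> carrier R" "s \<in> S" "x = fraction R S r s"
  using assms by (auto simp: carrier_localization)

text \<open>Reconciles denominators: in the laws below the two sides often come out as fractions
  expanded by different elements of \<open>S\<close>.\<close>

lemma fraction_cancel:
  assumes "r \<in> carrier R" "s \<in> S" "t \<in> S"
  shows "fraction R S (r \<otimes> t) (s \<otimes> t) = fraction R S r s"
  using assms S_nonempty S_closed by (subst fraction_eq_iff) (auto simp: m_ac)

lemma abelian_group_localization: "abelian_group (localization R S)"
proof (rule abelian_groupI)
  obtain t where t: "t \<in> S" using S_nonempty by blast
  show "\<zero>\<^bsub>localization R S\<^esub> \<in> carrier (localization R S)"
    using t by (simp add: localization_zero)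
  fix x assume "x \<in> carrier (localization R S)"
  then obtain a s where a [simp]: "a \<in> carrier R" "s \<in> S" and x: "x = fraction R S a s"
    by (rule carrier_localizationE)
  show "\<zero>\<^bsub>localization R S\<^esub> \<oplus>\<^bsub>localization R S\<^esub> x = x"
    using S_closed by (simp add: x localization_zero[of s] fraction_add fraction_cancel)
  have "\<ominus> a \<otimes> s \<oplus> a \<otimes> s = \<zero>"
    by (simp add: l_minus l_neg)
  \<comment> \<open>Zero is taken over the denominator \<open>s \<otimes> s\<close>, which is the
    one that \<open>fraction_add\<close> produces for two fractions over \<open>s\<close>.\<close>
  then have "fraction R S (\<ominus> a) s \<oplus>\<^bsub>localization R S\<^esub> x = \<zero>\<^bsub>localization R S\<^esub>"
    using S_closed by (simp add: x localization_zero[of "s \<otimes> s"] fraction_add)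
  then show "\<exists>y\<in>carrier (localization R S). y \<oplus>\<^bsub>localization R S\<^esub> x = \<zero>\<^bsub>localization R S\<^esub>"
    by (intro bexI[of _ "fraction R S (\<ominus> a) s"]) simp_all
  fix y assume "y \<in> carrier (localization R S)"
  then obtain b t where b [simp]: "b \<in> carrier R" "t \<in> S" and y: "y = fraction R S b t"
    by (rule carrier_localizationE)
  show "x \<oplus>\<^bsub>localization R S\<^esub> y \<in> carrier (localization R S)"
    using S_closed by (simp add: x y fraction_add)
  show "x \<oplus>\<^bsub>localization R S\<^esub> y = y \<oplus>\<^bsub>localization R S\<^esub> x"
    by (simp add: x y fraction_add a_comm m_comm[of s t])
  fix z assume "z \<in> carrier (localization R S)"
  then obtain c w where c [simp]: "c \<in> carrier R" "w \<in> S" and z: "z = fraction R S c w"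
    by (rule carrier_localizationE)
  show "x \<oplus>\<^bsub>localization R S\<^esub> y \<oplus>\<^bsub>localization R S\<^esub> z =
        x \<oplus>\<^bsub>localization R S\<^esub> (y \<oplus>\<^bsub>localization R S\<^esub> z)"
    using S_closed by (simp add: x y z fraction_add l_distr r_distr a_assoc m_ac)
qed

lemma comm_monoid_localization: "comm_monoid (localization R S)"
proof (rule comm_monoidI)
  obtain t where t: "t \<in> S" using S_nonempty by blast
  show "\<one>\<^bsub>localization R S\<^esub> \<in> carrier (localization R S)"
    using t by (simp add: localization_one)
  fix x assume "x \<in> carrier (localization R S)"
  then obtain a s where a [simp]: "a \<in> carrier R" "s \<in> S" and x: "x = fraction R S a s"
    by (rule carrier_localizationE)
  show "\<one>\<^bsub>localization R S\<^esub> \<otimes>\<^bsub>localization R S\<^esub> x = x"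
    by (simp add: x localization_one[of s] fraction_mult m_comm[of s a] fraction_cancel)
  fix y assume "y \<in> carrier (localization R S)"
  then obtain b t where b [simp]: "b \<in> carrier R" "t \<in> S" and y: "y = fraction R S b t"
    by (rule carrier_localizationE)
  show "x \<otimes>\<^bsub>localization R S\<^esub> y \<in> carrier (localization R S)"
    using S_closed by (simp add: x y fraction_mult)
  show "x \<otimes>\<^bsub>localization R S\<^esub> y = y \<otimes>\<^bsub>localization R S\<^esub> x"
    by (simp add: x y fraction_mult m_comm[of a b] m_comm[of s t])
  fix z assume "z \<in> carrier (localization R S)"
  then obtain c w where c [simp]: "c \<in> carrier R" "w \<in> S" and z: "z = fraction R S c w"
    by (rule carrier_localizationE)
  show "x \<otimes>\<^bsub>localization R S\<^esub> y \<otimes>\<^bsub>localization R S\<^esub> z =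
        x \<otimes>\<^bsub>localization R S\<^esub> (y \<otimes>\<^bsub>localization R S\<^esub> z)"
    using S_closed by (simp add: x y z fraction_mult m_assoc)
qed

lemma cring_localization: "cring (localization R S)"
proof (rule cringI[OF abelian_group_localization comm_monoid_localization])
  fix x y z
  assume "x \<in> carrier (localization R S)" "y \<in> carrier (localization R S)"
    "z \<in> carrier (localization R S)"
  then obtain a s b t c w where c [simp]: "a \<in> carrier R" "s \<in> S" "b \<in> carrier R" "t \<in> S"
      "c \<in> carrier R" "w \<in> S"
    and x: "x = fraction R S a s" and y: "y = fraction R S b t" and z: "z = fraction R S c w"
    by (metis carrier_localizationE)
  \<comment> \<open>Adding the two products puts \<open>w\<close> into the denominator twice and
    into the numerator once more than on the other side; the common extra factor \<open>w\<close> is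
    cancelled in the next step.\<close>
  have "x \<otimes>\<^bsub>localization R S\<^esub> z \<oplus>\<^bsub>localization R S\<^esub> y \<otimes>\<^bsub>localization R S\<^esub> z =
        fraction R S ((a \<otimes> t \<oplus> b \<otimes> s) \<otimes> c \<otimes> w) (s \<otimes> t \<otimes> w \<otimes> w)"
    using S_closed by (simp add: x y z fraction_add fraction_mult l_distr r_distr m_ac)
  also have "\<dots> = (x \<oplus>\<^bsub>localization R S\<^esub> y) \<otimes>\<^bsub>localization R S\<^esub> z"
    using S_closed by (simp add: x y z fraction_add fraction_mult fraction_cancel)
  finally show "(x \<oplus>\<^bsub>localization R S\<^esub> y) \<otimes>\<^bsub>localization R S\<^esub> z =
      x \<otimes>\<^bsub>localization R S\<^esub> z \<oplus>\<^bsub>localization R S\<^esub> y \<otimes>\<^bsub>localization R S\<^esub> z" ..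
qed

section \<open>The canonical map into a localization\<close>

lemma localization_map_eq:
  assumes "x \<in> carrier R" "s \<in> S"
  shows "localization_map R S x = fraction R S (x \<otimes> s) s"
proof -
  \<comment> \<open>Cross-multiplication gives \<open>x \<otimes> t \<otimes> s\<close> and
    \<open>x \<otimes> s \<otimes> t\<close>, so all classes in the defining union coincide.\<close>
  have "fraction R S (x \<otimes> t) t = fraction R S (x \<otimes> s) s" if "t \<in> S" for t
    using assms that by (subst fraction_eq_iff) (auto simp: m_ac)
  then show ?thesis using assms unfolding localization_map_def by blast
qed

lemma localization_map_closed:
  "x \<in> carrier R \<Longrightarrow> localization_map R S x \<in> carrier (localization R S)"
  using S_nonempty by (auto simp: localization_map_eq)

lemma localization_map_add:
  assumes [simp]: "x \<in> carrier R" "y \<in> carrier R"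
  shows "localization_map R S (x \<oplus> y) =
    localization_map R S x \<oplus>\<^bsub>localization R S\<^esub> localization_map R S y"
proof -
  obtain s where s [simp]: "s \<in> S" using S_nonempty by blast
  have "localization_map R S x \<oplus>\<^bsub>localization R S\<^esub> localization_map R S y =
    fraction R S ((x \<oplus> y) \<otimes> s \<otimes> s) (s \<otimes> s)"
    by (simp add: localization_map_eq[of _ s] fraction_add l_distr)
  then show ?thesis by (simp add: localization_map_eq[of _ s] fraction_cancel)
qed

lemma localization_map_mult:
  assumes [simp]: "x \<in> carrier R" "y \<in> carrier R"
  shows "localization_map R S (x \<otimes> y) =
    localization_map R S x \<otimes>\<^bsub>localization R S\<^esub> localization_map R S y"
proof -
  obtain s where s [simp]: "s \<in> S" using S_nonempty by blast
  have "localization_map R S x \<otimes>\<^bsub>localization R S\<^esub> localization_map R S y =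
    fraction R S (x \<otimes> y \<otimes> s \<otimes> s) (s \<otimes> s)"
    by (simp add: localization_map_eq[of _ s] fraction_mult m_ac)
  then show ?thesis by (simp add: localization_map_eq[of _ s] fraction_cancel)
qed

text \<open>Equality of the fractions over a common denominator \<open>s\<close> brings in the
  factor \<open>s \<otimes> s\<close>. It is absorbed into the witness \<open>u\<close> in one
  direction and multiplied in for the other.\<close>

lemma localization_map_eq_iff:
  assumes [simp]: "x \<in> carrier R" "y \<in> carrier R"
  shows "localization_map R S x = localization_map R S y \<longleftrightarrow> (\<exists>u\<in>S. x \<otimes> u = y \<otimes> u)"
proof -
  obtain s where s [simp]: "s \<in> S" using S_nonempty by blast
  have "localization_map R S x = localization_map R S y \<longleftrightarrow>
    (\<exists>u\<in>S. x \<otimes> s \<otimes> s \<otimes> u = y \<otimes> s \<otimes> s \<otimes> u)"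
    by (simp add: localization_map_eq[of _ s] fraction_eq_iff)
  also have "\<dots> \<longleftrightarrow> (\<exists>u\<in>S. x \<otimes> u = y \<otimes> u)" (is "?l \<longleftrightarrow> ?r")
  proof
    assume ?l
    then obtain u where "u \<in> S" "x \<otimes> (s \<otimes> s \<otimes> u) = y \<otimes> (s \<otimes> s \<otimes> u)"
      by (auto simp: m_assoc)
    then show ?r using S_closed s by blast
  next
    assume ?r
    then obtain u where "u \<in> S" "x \<otimes> u = y \<otimes> u" by blast
    then show ?l by (intro bexI[of _ u]) (simp_all add: m_ac)
  qed
  finally show ?thesis .
qed

lemma localization_map_zero: "localization_map R S \<zero> = \<zero>\<^bsub>localization R S\<^esub>"
  using S_nonempty by (auto simp: localization_map_eq localization_zero)

end

section \<open>Ideals of pseudorings\<close>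

context pseudoring_ideal
begin

lemma I_r_closed: "\<lbrakk>a \<in> I; x \<in> carrier R\<rbrakk> \<Longrightarrow> a \<otimes> x \<in> I"
  using I_l_closed a_Hcarr m_comm by fastforce

text \<open>The prefix separates closure properties of \<open>I\<close> from those of
  \<open>carrier R\<close>, which have the same base names.\<close>

lemmas I_zero_closed = additive_subgroup.zero_closed[OF additive_subgroup_axioms]

lemmas I_a_closed = additive_subgroup.a_closed[OF additive_subgroup_axioms]

lemmas I_a_inv_closed = additive_subgroup.a_inv_closed[OF additive_subgroup_axioms]

lemma I_abelian_subgroup: "abelian_subgroup I R"
  by (rule abelian_subgroupI3[OF additive_subgroup_axioms abelian_group_axioms])

text \<open>Puts coset membership into the difference form in which the fibres of the canonical map
  are described.\<close>

lemma a_rcos_iff: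
  assumes "x \<in> carrier R" "y \<in> carrier R"
  shows "y \<in> I +> x \<longleftrightarrow> y \<ominus> x \<in> I"
  using abelian_subgroup.a_rcos_module[OF I_abelian_subgroup] assms
  by (simp add: a_minus_def)

text \<open>The product of cosets is a union over all representatives \<open>a\<close>,
  \<open>b\<close>. By ab - xy = (a - x)b + x(b - y) every \<open>a \<otimes> b\<close> lies in the
  coset of \<open>x \<otimes> y\<close>, so the union is a single coset; it is non-empty since
  \<open>x\<close> and \<open>y\<close> are representatives themselves.\<close>

lemma rcoset_mult_pseudoring:
  assumes x: "x \<in> carrier R" and y: "y \<in> carrier R"
  shows "[mod I:] (I +> x) \<Otimes> (I +> y) = I +> (x \<otimes> y)"
proof -
  have carr: "a \<in> carrier R" if "a \<in> I +> z" "z \<in> carrier R" for a z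
    using that a_r_coset_subset_G[OF a_subset] by blast
  have self: "z \<in> I +> z" if "z \<in> carrier R" for z
    using that by (simp add: a_rcos_iff a_minus_def r_neg)
  have "I +> (a \<otimes> b) = I +> (x \<otimes> y)" if a: "a \<in> I +> x" and b: "b \<in> I +> y" for a b
  proof -
    have c: "a \<in> carrier R" "b \<in> carrier R" using a b x y carr by blast+
    have "a \<otimes> b \<ominus> x \<otimes> y = (a \<ominus> x) \<otimes> b \<oplus> x \<otimes> (b \<ominus> y)"
    proof -
      have "(a \<ominus> x) \<otimes> b \<oplus> x \<otimes> (b \<ominus> y) = a \<otimes> b \<oplus> (\<ominus> (x \<otimes> b) \<oplus> x \<otimes> b) \<oplus> \<ominus> (x \<otimes> y)"
        using c x y by (simp add: a_minus_def l_distr r_distr l_minus a_assoc m_comm[of x "\<ominus> y"]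
            m_comm[of y x])
      then show ?thesis using c x y by (simp add: l_neg a_minus_def)
    qed
    moreover have "(a \<ominus> x) \<otimes> b \<in> I" "x \<otimes> (b \<ominus> y) \<in> I"
      using a b c x y by (simp_all add: a_rcos_iff I_l_closed I_r_closed)
    ultimately have "a \<otimes> b \<in> I +> (x \<otimes> y)"
      using c x y by (simp add: a_rcos_iff I_a_closed)
    then show ?thesis
      using abelian_subgroup.a_repr_independence'[OF I_abelian_subgroup] x y abelian_group_axioms
      by (metis m_closed)
  qed
  then show ?thesis using self x y unfolding rcoset_mult_def by blast
qed

text \<open>Supplies the larger ideal against which maximality is tested. In a general pseudoring
  \<open>s\<close> need not belong to I + Rs; in a pseudomeadow it does, because s = e(s)s.\<close>

lemma ideal_generated_over:
  assumes s: "s \<in> carrier R"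
  shows "pseudoring_ideal {m \<oplus> r \<otimes> s | m r. m \<in> I \<and> r \<in> carrier R} R"
proof -
  let ?J = "{m \<oplus> r \<otimes> s | m r. m \<in> I \<and> r \<in> carrier R}"
  have "subgroup ?J (add_monoid R)"
  proof (rule add.subgroupI)
    show "?J \<subseteq> carrier R" using s a_Hcarr by auto
    have "\<zero> \<oplus> s \<otimes> s \<in> ?J" using s I_zero_closed by blast
    then show "?J \<noteq> {}" by (metis (no_types, lifting) empty_iff)
    fix a assume "a \<in> ?J"
    then obtain m r where m: "m \<in> I" "r \<in> carrier R" and a: "a = m \<oplus> r \<otimes> s"
      by (elim CollectE exE conjE)
    have "\<ominus> a = \<ominus> m \<oplus> \<ominus> r \<otimes> s"
      using m s a_Hcarr by (simp add: a minus_add l_minus)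
    then show "\<ominus> a \<in> ?J" using m I_a_inv_closed a_inv_closed by blast
    fix b assume "b \<in> ?J"
    then obtain n q where n: "n \<in> I" "q \<in> carrier R" and b: "b = n \<oplus> q \<otimes> s" by blast
    have "a \<oplus> b = (m \<oplus> n) \<oplus> (r \<oplus> q) \<otimes> s"
      using m n s a_Hcarr by (simp add: a b l_distr a_ac)
    then show "a \<oplus> b \<in> ?J" using m n I_a_closed a_closed by blast
  qed
  moreover have "x \<otimes> a \<in> ?J" if "a \<in> ?J" and x: "x \<in> carrier R" for a x
  proof -
    from \<open>a \<in> ?J\<close> obtain m r where m: "m \<in> I" "r \<in> carrier R" and a: "a = m \<oplus> r \<otimes> s"
      by (elim CollectE exE conjE)
    have "x \<otimes> a = x \<otimes> m \<oplus> (x \<otimes> r) \<otimes> s"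
      using m s x a_Hcarr by (simp add: a r_distr m_assoc)
    then show ?thesis using m x I_l_closed[of m x] m_closed[of x r] by blast
  qed
  ultimately show ?thesis
    using pseudoring_axioms
    by (simp add: pseudoring_ideal_def additive_subgroup_def pseudoring_ideal_axioms_def)
qed

end

section \<open>Maximal ideals of pseudomeadows\<close>

context pseudomeadow
begin

lemma vn_inv_closed [simp]: "x \<in> carrier R \<Longrightarrow> vn_inv R x \<in> carrier R"
  using vn_inv by (auto simp: is_vn_inverse_def)

lemma mult_vn_inv: "x \<in> carrier R \<Longrightarrow> x \<otimes> x \<otimes> vn_inv R x = x"
  using vn_inv by (auto simp: is_vn_inverse_def)

lemma vn_idem_closed [simp]: "x \<in> carrier R \<Longrightarrow> vn_idem R x \<in> carrier R"
  by (simp add: vn_idem_def)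

text \<open>The local substitute for an identity, obtained by rearranging the first equation of the
  von Neumann inverse.\<close>

lemma vn_idem_mult: "x \<in> carrier R \<Longrightarrow> vn_idem R x \<otimes> x = x"
  using mult_vn_inv by (simp add: vn_idem_def m_ac)

end

locale pseudomeadow_maximal_ideal = pseudomeadow R + pseudoring_maximal_ideal M R
  for R (structure) and M
begin

text \<open>If \<open>x\<close> is outside \<open>M\<close>, maximality gives M + Rx = R, so y = m +
  rx. The usual argument multiplies a decomposition of 1 by \<open>y\<close>; here \<open>y\<close>
  itself is decomposed and then multiplied by e(y).\<close>

lemma prime:
  assumes x: "x \<in> carrier R" and y: "y \<in> carrier R" and xy: "x \<otimes> y \<in> M"
  shows "x \<in> M \<or> y \<in> M"
proof (rule ccontr)
  assume "\<not> (x \<in> M \<or> y \<in> M)"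
  then have xM: "x \<notin> M" and yM: "y \<notin> M" by auto
  let ?J = "{m \<oplus> r \<otimes> x | m r. m \<in> M \<and> r \<in> carrier R}"
  have "M \<subseteq> ?J"
  proof
    fix m assume m: "m \<in> M"
    then have "m = m \<oplus> \<zero> \<otimes> x" using x a_Hcarr by simp
    then show "m \<in> ?J" using m zero_closed by blast
  qed
  moreover have "x \<in> ?J"
  proof -
    have "x = \<zero> \<oplus> vn_idem R x \<otimes> x" using x by (simp add: vn_idem_mult)
    then show ?thesis using x I_zero_closed vn_idem_closed[of x] by blast
  qed
  ultimately have "?J = carrier R"
    using maximal[OF ideal_generated_over[OF x]] xM by blast
  then obtain m r where m: "m \<in> M" "r \<in> carrier R" and y_eq: "y = m \<oplus> r \<otimes> x"
    using y by blast
  have mc: "m \<in> carrier R" using m a_Hcarr by blast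
  have "y = vn_idem R y \<otimes> (m \<oplus> r \<otimes> x)" using y vn_idem_mult y_eq by metis
  \<comment> \<open>The factor \<open>y\<close> hidden in e(y) is moved next to \<open>x\<close>, so
    that the second summand becomes a multiple of \<open>x \<otimes> y\<close>.\<close>
  also have "\<dots> = vn_idem R y \<otimes> m \<oplus> (vn_inv R y \<otimes> r) \<otimes> (x \<otimes> y)"
    using x y m mc by (simp add: r_distr vn_idem_def m_ac)
  also have "\<dots> \<in> M" using m x y xy by (simp add: I_a_closed I_l_closed)
  finally show False using yM by blast
qed

text \<open>The complement of \<open>M\<close> is non-empty by properness and multiplicatively
  closed by primeness.\<close>

sublocale loc: pseudoring_localization R "carrier R - M"
  using proper a_subset prime by unfold_locales auto

text \<open>As a simp rule, this instance of \<open>S_carrier\<close> would loop on its own premise \<open>s \<in> carrier R\<close>.\<close>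

declare loc.S_carrier [simp del]

text \<open>From left to right this is primeness applied to the product \<open>\<zero>\<close>,
  which lies in \<open>M\<close>. The converse needs an explicit annihilator.\<close>

lemma annihilated_iff:
  assumes x: "x \<in> carrier R"
  shows "(\<exists>u\<in>carrier R - M. x \<otimes> u = \<zero>) \<longleftrightarrow> x \<in> M"
proof
  assume "\<exists>u\<in>carrier R - M. x \<otimes> u = \<zero>"
  then show "x \<in> M" using prime[OF x] I_zero_closed by fastforce
next
  assume xM: "x \<in> M"
  obtain s where s: "s \<in> carrier R" "s \<notin> M" using loc.S_nonempty by blast
  \<comment> \<open>This is (1 - e(x))s written without an identity. It differs from
    \<open>s\<close> by an element of \<open>M\<close>, hence is outside \<open>M\<close>, and
    \<open>x\<close> kills it because e(x)x = x.\<close>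
  let ?u = "s \<ominus> vn_idem R x \<otimes> s"
  have e: "vn_idem R x \<otimes> s \<in> M"
    using xM x s by (simp add: vn_idem_def I_r_closed)
  have "s = ?u \<oplus> vn_idem R x \<otimes> s"
    using s x by (simp add: a_minus_def a_assoc l_neg)
  then have "?u \<notin> M" using e s I_a_closed by metis
  moreover have "x \<otimes> ?u = \<zero>"
  proof -
    have "vn_idem R x \<otimes> s \<otimes> x = s \<otimes> x"
      using x s by (metis m_assoc m_comm vn_idem_closed vn_idem_mult)
    then have "?u \<otimes> x = \<zero>"
      using x s by (simp add: minus_mult_eq_zero_iff)
    then show ?thesis using x s by (simp add: m_comm[of x])
  qed
  moreover have "?u \<in> carrier R" using x s by simp
  ultimately show "\<exists>u\<in>carrier R - M. x \<otimes> u = \<zero>" by blast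
qed

section \<open>Fibres and image of the canonical map at \<open>M\<close>\<close>

lemma localization_map_at_eq_iff:
  assumes "x \<in> carrier R" "y \<in> carrier R"
  shows "localization_map_at R M x = localization_map_at R M y \<longleftrightarrow> x \<ominus> y \<in> M"
proof -
  have "(\<exists>u\<in>carrier R - M. x \<otimes> u = y \<otimes> u) \<longleftrightarrow> (\<exists>u\<in>carrier R - M. (x \<ominus> y) \<otimes> u = \<zero>)"
    using assms by (auto simp: minus_mult_eq_zero_iff)
  then show ?thesis
    using assms by (simp add: loc.localization_map_eq_iff annihilated_iff)
qed

lemma localization_map_at_eq_zero_iff:
  assumes x: "x \<in> carrier R"
  shows "localization_map_at R M x = \<zero>\<^bsub>localization_at R M\<^esub> \<longleftrightarrow> x \<in> M"
  using localization_map_at_eq_iff[OF x add.one_closed] x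
  by (simp add: loc.localization_map_zero a_minus_def minus_equality[of \<zero> \<zero>])

text \<open>Cross-multiplication reduces the claim to the defining equation
  \<open>s \<otimes> s \<otimes> vn_inv R s = s\<close>. Division by \<open>s\<close> is thus
  multiplication by an element of \<open>R\<close>, which yields surjectivity.\<close>

lemma fraction_at_eq_map:
  assumes x: "x \<in> carrier R" and s: "s \<in> carrier R - M"
  shows "fraction_at R M x s = localization_map_at R M (x \<otimes> vn_inv R s)"
proof -
  have "fraction_at R M (x \<otimes> vn_inv R s \<otimes> s) s = fraction_at R M x s"
  proof (subst loc.fraction_eq_iff)
    have "x \<otimes> vn_inv R s \<otimes> s \<otimes> s \<otimes> s = x \<otimes> (s \<otimes> s \<otimes> vn_inv R s) \<otimes> s"
      using x s by (simp add: m_ac)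
    also have "\<dots> = x \<otimes> s \<otimes> s" using s by (simp add: mult_vn_inv)
    finally show "\<exists>u\<in>carrier R - M. x \<otimes> vn_inv R s \<otimes> s \<otimes> s \<otimes> u = x \<otimes> s \<otimes> u"
      using s by blast
  qed (use x s in auto)
  then show ?thesis using x s by (simp add: loc.localization_map_eq[of _ s])
qed

lemma localization_map_at_surj:
  "localization_map_at R M ` carrier R = carrier (localization_at R M)"
proof
  show "localization_map_at R M ` carrier R \<subseteq> carrier (localization_at R M)"
    using loc.localization_map_closed by blast
  show "carrier (localization_at R M) \<subseteq> localization_map_at R M ` carrier R"
  proof
    fix z assume "z \<in> carrier (localization_at R M)"
    then obtain x s where x: "x \<in> carrier R" "s \<in> carrier R - M" and "z = fraction_at R M x s"
      by (rule loc.carrier_localizationE)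
    then have "z = localization_map_at R M (x \<otimes> vn_inv R s)"
      by (simp only: fraction_at_eq_map)
    then show "z \<in> localization_map_at R M ` carrier R"
      by (rule image_eqI) (use x in simp)
  qed
qed

section \<open>Vanishing of fractions and the field property\<close>

lemma fraction_at_eq_zero_iff:
  assumes x: "x \<in> carrier R" and s: "s \<in> carrier R - M"
  shows "fraction_at R M x s = \<zero>\<^bsub>localization_at R M\<^esub> \<longleftrightarrow> x \<in> M"
proof -
  have "x \<otimes> vn_inv R s \<in> M \<longleftrightarrow> x \<in> M"
  proof
    assume "x \<otimes> vn_inv R s \<in> M"
    \<comment> \<open>Otherwise s = s s s^(-1) would lie in \<open>M\<close>.\<close>
    moreover have "vn_inv R s \<notin> M"
      using s mult_vn_inv[of s] I_l_closed[of "vn_inv R s" "s \<otimes> s"] by auto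
    ultimately show "x \<in> M" using prime[of x "vn_inv R s"] x s by auto
  qed (use I_r_closed s in auto)
  then show ?thesis
    using x s by (simp add: fraction_at_eq_map localization_map_at_eq_zero_iff)
qed

lemma localized_ideal_at_self: "localized_ideal_at R M M = {\<zero>\<^bsub>localization_at R M\<^esub>}"
proof -
  obtain s where s: "s \<in> carrier R - M" using loc.S_nonempty by blast
  have "fraction_at R M a t = \<zero>\<^bsub>localization_at R M\<^esub>" if "a \<in> M" "t \<in> carrier R - M" for a t
    using that by (simp add: fraction_at_eq_zero_iff a_Hcarr)
  then have "localized_ideal_at R M M \<subseteq> {\<zero>\<^bsub>localization_at R M\<^esub>}"
    unfolding localized_ideal_def by blast
  moreover have "\<zero>\<^bsub>localization_at R M\<^esub> \<in> localized_ideal_at R M M"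
    unfolding localized_ideal_def loc.localization_zero[OF s] using s I_zero_closed by blast
  ultimately show ?thesis by blast
qed

lemma field_localization_at: "field (localization_at R M)"
proof (rule cring.cring_fieldI2[OF loc.cring_localization])
  obtain s where s: "s \<in> carrier R - M" using loc.S_nonempty by blast
  show "\<zero>\<^bsub>localization_at R M\<^esub> \<noteq> \<one>\<^bsub>localization_at R M\<^esub>"
    using s fraction_at_eq_zero_iff[of s s] by (auto simp: loc.localization_one[OF s])
  fix a assume "a \<in> carrier (localization_at R M)" and nz: "a \<noteq> \<zero>\<^bsub>localization_at R M\<^esub>"
  from \<open>a \<in> _\<close> obtain r s
    where r: "r \<in> carrier R" "s \<in> carrier R - M" and a: "a = fraction_at R M r s"
    by (rule loc.carrier_localizationE)
  \<comment> \<open>The numerator of a nonzero fraction lies outside \<open>M\<close> and is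
    therefore an admissible denominator; the inverse of r/s is s/r.\<close>
  have rM: "r \<in> carrier R - M" using nz r by (auto simp: a fraction_at_eq_zero_iff)
  have "a \<otimes>\<^bsub>localization_at R M\<^esub> fraction_at R M s r = \<one>\<^bsub>localization_at R M\<^esub>"
    using r rM loc.S_closed
    by (simp add: a loc.fraction_mult m_comm[of s r] loc.localization_one[of "r \<otimes> s"])
  then show "\<exists>b\<in>carrier (localization_at R M). a \<otimes>\<^bsub>localization_at R M\<^esub> b = \<one>\<^bsub>localization_at R M\<^esub>"
    using r rM by (intro bexI[of _ "fraction_at R M s r"]) auto
qed

section \<open>The isomorphism from the quotient\<close>

lemma induced_localization_map_at:
  assumes x: "x \<in> carrier R"
  shows "induced_map (localization_map_at R M) (M +> x) = localization_map_at R M x"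
proof -
  have "y \<in> carrier R" if "y \<in> M +> x" for y
    using that x a_r_coset_subset_G[OF a_subset] by blast
  \<comment> \<open>The map is constant on the coset, so the image of the coset is a singleton and
    \<open>the_elem\<close> returns its value.\<close>
  then have "localization_map_at R M y = localization_map_at R M x" if "y \<in> M +> x" for y
    using that x by (simp add: localization_map_at_eq_iff flip: a_rcos_iff)
  moreover have "x \<in> M +> x" using x by (simp add: a_rcos_iff a_minus_def r_neg)
  ultimately have "localization_map_at R M ` (M +> x) = {localization_map_at R M x}"
    by blast
  then show ?thesis by (simp add: induced_map_def)
qed

text \<open>Injectivity holds because elements with equal images differ by a member of
  \<open>M\<close> and so share a coset; surjectivity and compatibility with the operations are
  inherited from the canonical map through representatives.\<close>

lemma induced_localization_map_at_iso:
  "induced_map (localization_map_at R M) \<in> pseudoring_iso (FactRing R M) (localization_at R M)"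
proof -
  let ?h = "induced_map (localization_map_at R M)"
  have coset: "X \<in> carrier (FactRing R M) \<longleftrightarrow> (\<exists>x\<in>carrier R. X = M +> x)" for X
    by (auto simp: FactRing_def A_RCOSETS_def')
  have "inj_on ?h (carrier (FactRing R M))"
  proof (rule inj_onI)
    fix X Y assume "X \<in> carrier (FactRing R M)" "Y \<in> carrier (FactRing R M)" "?h X = ?h Y"
    then obtain x y where x: "x \<in> carrier R" "X = M +> x" and y: "y \<in> carrier R" "Y = M +> y"
      and "x \<in> M +> y"
      by (auto simp: coset induced_localization_map_at localization_map_at_eq_iff a_rcos_iff)
    then show "X = Y"
      using abelian_subgroup.a_repr_independence'[OF I_abelian_subgroup] abelian_group_axioms by blast
  qed
  moreover have "?h ` carrier (FactRing R M) = carrier (localization_at R M)"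
  proof -
    have "carrier (FactRing R M) = (\<lambda>x. M +> x) ` carrier R" using coset by auto
    then show ?thesis
      by (simp add: image_image induced_localization_map_at flip: localization_map_at_surj)
  qed
  moreover have "?h (X \<oplus>\<^bsub>FactRing R M\<^esub> Y) = ?h X \<oplus>\<^bsub>localization_at R M\<^esub> ?h Y \<and>
      ?h (X \<otimes>\<^bsub>FactRing R M\<^esub> Y) = ?h X \<otimes>\<^bsub>localization_at R M\<^esub> ?h Y"
    if XY: "X \<in> carrier (FactRing R M)" "Y \<in> carrier (FactRing R M)" for X Y
  proof -
    obtain x y where x: "x \<in> carrier R" "X = M +> x" and y: "y \<in> carrier R" "Y = M +> y"
      using XY by (auto simp: coset)
    have "X \<oplus>\<^bsub>FactRing R M\<^esub> Y = M +> (x \<oplus> y)"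
      using x y abelian_subgroup.a_rcos_sum[OF I_abelian_subgroup] by (simp add: FactRing_def)
    moreover have "X \<otimes>\<^bsub>FactRing R M\<^esub> Y = M +> (x \<otimes> y)"
      using x y rcoset_mult_pseudoring by (simp add: FactRing_def)
    ultimately show ?thesis
      using x y by (simp add: induced_localization_map_at loc.localization_map_add
          loc.localization_map_mult)
  qed
  ultimately show ?thesis by (simp add: pseudoring_iso_def bij_betw_def)
qed

section \<open>Preimages of the identity\<close>

lemma fraction_at_self_eq_map:
  "s \<in> carrier R - M \<Longrightarrow> fraction_at R M s s = localization_map_at R M (vn_idem R s)"
  by (simp add: loc.localization_map_eq[of _ s] vn_idem_mult)

lemma localization_map_at_vimage_one:
  assumes s: "s \<in> carrier R - M"
  shows "{x \<in> carrier R. localization_map_at R M x = fraction_at R M s s} = M +> vn_idem R s"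
proof -
  \<comment> \<open>The fibre is a subset of \<open>carrier R\<close> by definition, so the coset
    has to be one as well before elements of the carrier are compared.\<close>
  have "M +> vn_idem R s \<subseteq> carrier R"
    using s by (simp add: a_r_coset_subset_G[OF a_subset])
  moreover have "localization_map_at R M x = fraction_at R M s s \<longleftrightarrow> x \<in> M +> vn_idem R s"
    if "x \<in> carrier R" for x
    using that s by (simp add: fraction_at_self_eq_map localization_map_at_eq_iff a_rcos_iff)
  ultimately show ?thesis by blast
qed

text \<open>Both s/s and t/t are the identity of the localization, so the two idempotents have the
  same image.\<close>

lemma vn_idem_minus_mem:
  assumes "s \<in> carrier R - M" "t \<in> carrier R - M"
  shows "vn_idem R s \<ominus> vn_idem R t \<in> M"
proof -
  have "fraction_at R M s s = fraction_at R M t t"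
    using assms by (metis loc.localization_one)
  then show ?thesis using assms by (simp add: fraction_at_self_eq_map localization_map_at_eq_iff)
qed

end

theorem theorem5p2:
  fixes R (structure) and M
  assumes "pseudomeadow R"
    and "pseudoring_maximal_ideal M R"
  shows
    \<comment> \<open>(a)\<close>
    "(field (localization_at R M) \<and>
      localized_ideal_at R M M = {\<zero>\<^bsub>localization_at R M\<^esub>}) \<and>
    \<comment> \<open>(b)\<close>
     ((\<forall>x\<in>carrier R. \<forall>s\<in>carrier R - M.
         localization_map_at R M x = fraction_at R M (x \<otimes> s) s) \<and>
      localization_map_at R M ` carrier R = carrier (localization_at R M) \<and>
      a_kernel R (localization_at R M) (localization_map_at R M) = M \<and>
      (\<forall>x\<in>carrier R. \<forall>s\<in>carrier R - M.
         induced_map (localization_map_at R M) (M +> x) = fraction_at R M (x \<otimes> s) s) \<and>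
      induced_map (localization_map_at R M) \<in>
        pseudoring_iso (FactRing R M) (localization_at R M)) \<and>
    \<comment> \<open>(c)\<close>
     (\<forall>s\<in>carrier R - M.
        {x \<in> carrier R. localization_map_at R M x = fraction_at R M s s} = M +> vn_idem R s) \<and>
    \<comment> \<open>(d)\<close>
     (\<forall>s\<^sub>1\<in>carrier R - M. \<forall>s\<^sub>2\<in>carrier R - M. vn_idem R s\<^sub>1 \<ominus> vn_idem R s\<^sub>2 \<in> M)"
proof -
  interpret pseudomeadow_maximal_ideal R M
    using assms by (simp add: pseudomeadow_maximal_ideal_def)
  have "a_kernel R (localization_at R M) (localization_map_at R M) = M"
    using a_Hcarr by (fastforce simp: a_kernel_def kernel_def localization_map_at_eq_zero_iff)
  then show ?thesis
    using field_localization_at localized_ideal_at_self localization_map_at_surj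
      induced_localization_map_at_iso localization_map_at_vimage_one vn_idem_minus_mem
    by (simp add: loc.localization_map_eq induced_localization_map_at)
qed

end
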